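(* There exists a spin system (with unit weights, a collection of blocks $\Theta_k$ covering $V$, update rules $P^{[k]}$, couplings $\Psi_k$, and an order on the blocks) for which $\alpha_W<1$ and $\alpha=1$ but the systematic scan Markov chain with transition matrix $P_{\rightarrow}=\prod_{k}P^{[k]}$ does not mix, i.e. it does not converge to $\pi$ in total variation distance from every initial configuration.
   Context: A spin system consists of a finite graph with site set $V$, a finite set $C$ of spins, the set $\Omega^+$ of all configurations (maps $V\to C$), and a probability distribution $\pi$ on $\Omega^+$. $S_i$ is the set of pairs of configurations agreeing at all sites other than $i$. The blocks $\Theta_k\subseteq V$ satisfy $\bigcup_k\Theta_k=V$. With each block is associated a transition matrix $P^{[k]}$ on $\Omega^+$ such that (1) $P^{[k]}(x,y)>0$ implies $x=y$ on $V\setminus\Theta_k$, and (2) $\pi$ is invariant with respect to $P^{[k]}$. For each $k$ and pair of configurations $(x,y)$, $\Psi_k(x,y)$ is a coupling of the distributions $P^{[k]}(x)$ and $P^{[k]}(y)$ obtained by applying $P^{[k]}$ once to $x$ and to $y$. $\rho_{i,j}^k=\max_{(x,y)\in S_i}\Pr_{(x',y')\in\Psi_k(x,y)}(x'_j\neq y'_j)$. With unit weights, $\alpha=\max_k\max_{j\in\Theta_k}\sum_{i\in V}\rho_{i,j}^k$. Let $B(j)$ be the set of indices of blocks containing site $j$ and $b(j)=|B(j)|$; then $\alpha_W=\max_j\sum_{k\in B(j)}\sum_{i\in V}\frac{\rho_{i,j}^k}{b(j)}$. *)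

theory Defs
  imports "HOL-Probability.Probability_Mass_Function"
begin

text \<open>
  Existential quantification over types is not available, so sites and spins are natural numbers;
  any finite site set and spin set can be named in this way.
  The blocks carry the indices \<open>0, \<dots>, m - 1\<close>.
\<close>

type_synonym site = nat
type_synonym spin = nat
type_synonym config = "site \<Rightarrow> spin"

definition configs :: "site set \<Rightarrow> spin set \<Rightarrow> config set" where
  "configs V C = (V \<rightarrow>\<^sub>E C)"

definition spin_system ::
  "site set \<Rightarrow> site set set \<Rightarrow> spin set \<Rightarrow> config pmf \<Rightarrow> bool" where
  "spin_system V E C \<pi> \<longleftrightarrow>
     finite V \<and> V \<noteq> {} \<and> (\<forall>e\<in>E. e \<subseteq> V \<and> card e = 2) \<and>
     finite C \<and> C \<noteq> {} \<and> set_pmf \<pi> \<subseteq> configs V C"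

text \<open>
  A transition matrix is given by its rows: \<open>pmf (P k x) y\<close> is the entry at \<open>(x, y)\<close> of the
  matrix of block \<open>k\<close>.
\<close>

definition block_updates ::
  "site set \<Rightarrow> spin set \<Rightarrow> config pmf \<Rightarrow> nat \<Rightarrow> (nat \<Rightarrow> site set)
    \<Rightarrow> (nat \<Rightarrow> config \<Rightarrow> config pmf) \<Rightarrow> bool" where
  "block_updates V C \<pi> m \<Theta> P \<longleftrightarrow>
     (\<Union>k<m. \<Theta> k) = V \<and>
     (\<forall>k<m. (\<forall>x\<in>configs V C. set_pmf (P k x) \<subseteq> configs V C) \<and>
            (\<forall>x\<in>configs V C. \<forall>y\<in>configs V C.
               pmf (P k x) y > 0 \<longrightarrow> (\<forall>i\<in>V - \<Theta> k. x i = y i)) \<and>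
            bind_pmf \<pi> (P k) = \<pi>)"

definition is_coupling :: "('a \<times> 'b) pmf \<Rightarrow> 'a pmf \<Rightarrow> 'b pmf \<Rightarrow> bool" where
  "is_coupling \<psi> \<mu> \<nu> \<longleftrightarrow> map_pmf fst \<psi> = \<mu> \<and> map_pmf snd \<psi> = \<nu>"

definition block_couplings ::
  "site set \<Rightarrow> spin set \<Rightarrow> nat \<Rightarrow> (nat \<Rightarrow> config \<Rightarrow> config pmf)
    \<Rightarrow> (nat \<Rightarrow> config \<Rightarrow> config \<Rightarrow> (config \<times> config) pmf) \<Rightarrow> bool" where
  "block_couplings V C m P \<Psi> \<longleftrightarrow>
     (\<forall>k<m. \<forall>x\<in>configs V C. \<forall>y\<in>configs V C. is_coupling (\<Psi> k x y) (P k x) (P k y))"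

definition agree_except :: "site set \<Rightarrow> spin set \<Rightarrow> site \<Rightarrow> (config \<times> config) set" where
  "agree_except V C i =
     {(x, y). x \<in> configs V C \<and> y \<in> configs V C \<and> (\<forall>l\<in>V - {i}. x l = y l)}"

definition influence ::
  "site set \<Rightarrow> spin set \<Rightarrow> (nat \<Rightarrow> config \<Rightarrow> config \<Rightarrow> (config \<times> config) pmf)
    \<Rightarrow> nat \<Rightarrow> site \<Rightarrow> site \<Rightarrow> real" where
  "influence V C \<Psi> k i j =
     (MAX (x, y)\<in>agree_except V C i.
        measure_pmf.prob (\<Psi> k x y) {(x', y'). x' j \<noteq> y' j})"

text \<open>
  The two maxima of \<open>max\<^sub>k max\<^sub>j\<close> are taken jointly over the pairs \<open>(k, j)\<close> with \<open>j \<in> \<Theta> k\<close>, so that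
  an empty block contributes nothing instead of an unspecified maximum of the empty set.
\<close>

definition alpha ::
  "site set \<Rightarrow> spin set \<Rightarrow> nat \<Rightarrow> (nat \<Rightarrow> site set)
    \<Rightarrow> (nat \<Rightarrow> config \<Rightarrow> config \<Rightarrow> (config \<times> config) pmf) \<Rightarrow> real" where
  "alpha V C m \<Theta> \<Psi> = (MAX (k, j)\<in>Sigma {..<m} \<Theta>. \<Sum>i\<in>V. influence V C \<Psi> k i j)"

definition blocks_of :: "nat \<Rightarrow> (nat \<Rightarrow> site set) \<Rightarrow> site \<Rightarrow> nat set" where
  "blocks_of m \<Theta> j = {k. k < m \<and> j \<in> \<Theta> k}"

definition alpha_W ::
  "site set \<Rightarrow> spin set \<Rightarrow> nat \<Rightarrow> (nat \<Rightarrow> site set)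
    \<Rightarrow> (nat \<Rightarrow> config \<Rightarrow> config \<Rightarrow> (config \<times> config) pmf) \<Rightarrow> real" where
  "alpha_W V C m \<Theta> \<Psi> =
     (MAX j\<in>V. \<Sum>k\<in>blocks_of m \<Theta> j. \<Sum>i\<in>V.
        influence V C \<Psi> k i j / real (card (blocks_of m \<Theta> j)))"

text \<open>
  \<open>scan P [k\<^sub>1, \<dots>, k\<^sub>m]\<close> is the matrix product \<open>P k\<^sub>1 \<cdots> P k\<^sub>m\<close> of row-stochastic matrices: the
  update of the first block in the list is applied first.
\<close>

fun scan :: "(nat \<Rightarrow> config \<Rightarrow> config pmf) \<Rightarrow> nat list \<Rightarrow> config \<Rightarrow> config pmf" where
  "scan P [] x = return_pmf x"
| "scan P (k # ks) x = bind_pmf (P k x) (scan P ks)"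

fun chain_dist :: "('a \<Rightarrow> 'a pmf) \<Rightarrow> nat \<Rightarrow> 'a \<Rightarrow> 'a pmf" where
  "chain_dist K 0 x = return_pmf x"
| "chain_dist K (Suc t) x = bind_pmf (chain_dist K t x) K"

definition tv_dist :: "'a set \<Rightarrow> 'a pmf \<Rightarrow> 'a pmf \<Rightarrow> real" where
  "tv_dist S \<mu> \<nu> = (\<Sum>z\<in>S. \<bar>pmf \<mu> z - pmf \<nu> z\<bar>) / 2"

definition mixes :: "'a set \<Rightarrow> ('a \<Rightarrow> 'a pmf) \<Rightarrow> 'a pmf \<Rightarrow> bool" where
  "mixes S K \<pi> \<longleftrightarrow> (\<forall>x\<in>S. (\<lambda>t. tv_dist S (chain_dist K t x) \<pi>) \<longlonglongrightarrow> 0)"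

end

theory Submission
  imports Defs
begin

text \<open>
  Two sites carry bits, and there are two blocks, both equal to the whole site set. Block \<open>k\<close> moves
  the bit of site \<open>k\<close> to the other site and puts a fair random bit on site \<open>k\<close>; this preserves the
  uniform distribution. Under block \<open>k\<close>, the coupling that shares the random bit lets only site
  \<open>k\<close> influence the other site, with influence 1. So every site has total influence 1 from one
  block and 0 from the other, with mean 1/2. But the scan of block 0 followed by block 1 carries the
  bit of site 0 to site 1 and back again, so this bit never changes.
\<close>

definition bit :: "spin pmf" where
  "bit = pmf_of_set {..<2}"

text \<open>Naming the refreshed site \<open>k\<close> first lets one formula serve both blocks. Off
  the two sites the value is \<open>undefined\<close>, as membership in the extensional space
  \<open>configs\<close> demands.\<close>

definition cfg :: "site \<Rightarrow> spin \<Rightarrow> spin \<Rightarrow> config" where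
  "cfg k r s = (\<lambda>j\<in>{..<2}. if j = k then r else s)"

definition unif :: "config pmf" where
  "unif = bind_pmf bit (\<lambda>a. bind_pmf bit (\<lambda>b. return_pmf (cfg 0 a b)))"

definition upd :: "nat \<Rightarrow> config \<Rightarrow> config pmf" where
  "upd k x = map_pmf (\<lambda>r. cfg k r (x k)) bit"

definition cpl :: "nat \<Rightarrow> config \<Rightarrow> config \<Rightarrow> (config \<times> config) pmf" where
  "cpl k x y = map_pmf (\<lambda>r. (cfg k r (x k), cfg k r (y k))) bit"

lemma set_bit: "set_pmf bit = {..<2}"
  unfolding bit_def by (intro set_pmf_of_set) (auto simp: lessThan_empty_iff)

lemma cfg_apply: "j < 2 \<Longrightarrow> cfg k r s j = (if j = k then r else s)"
  by (simp add: cfg_def)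

lemma cfg_swap: "cfg 1 a b = cfg 0 b a"
  by (auto simp: cfg_def fun_eq_iff)

lemma cfg_in_configs: "r < 2 \<Longrightarrow> s < 2 \<Longrightarrow> cfg k r s \<in> configs {..<2} {..<2}"
  by (auto simp: cfg_def configs_def)

lemma configs_bound: "x \<in> configs {..<2} {..<2} \<Longrightarrow> k < 2 \<Longrightarrow> x k < 2"
  by (auto simp: configs_def)

lemma finite_configs: "finite (configs {..<2} {..<2})"
  by (auto simp: configs_def intro!: finite_PiE)

lemma upd_in_configs:
  assumes "k < 2" "x \<in> configs {..<2} {..<2}"
  shows "set_pmf (upd k x) \<subseteq> configs {..<2} {..<2}"
  using configs_bound[OF assms(2,1)] by (auto simp: upd_def set_bit intro!: cfg_in_configs)

lemma unif_invariant:
  assumes "k < 2"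
  shows "bind_pmf unif (upd k) = unif"
proof -
  have upd_bind: "upd l = (\<lambda>x. bind_pmf bit (\<lambda>r. return_pmf (cfg l r (x l))))" for l
    by (simp add: upd_def map_pmf_def fun_eq_iff)
  consider "k = 0" | "k = 1"
    using assms by linarith
  then show ?thesis
  proof cases
    case 1
    have "bind_pmf unif (upd k) =
        bind_pmf bit (\<lambda>a. bind_pmf bit (\<lambda>r. return_pmf (cfg 0 r a)))"
      unfolding unif_def upd_bind 1
      by (simp add: bind_assoc_pmf bind_return_pmf cfg_apply)
    \<comment> \<open>Here the fresh bit lands in the first coordinate but is drawn second;
      independence of the two draws allows swapping them. For \<open>k = 1\<close>,
      \<open>cfg_swap\<close> already yields the order of \<open>unif\<close>.\<close>
    also have "\<dots> = unif"
      unfolding unif_def by (subst bind_commute_pmf) simp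
    finally show ?thesis .
  next
    case 2
    show ?thesis
      unfolding unif_def upd_bind 2 cfg_swap
      by (simp add: bind_assoc_pmf bind_return_pmf cfg_apply)
  qed
qed

text \<open>Both copies receive the same \<open>r\<close> on site \<open>k\<close>, and their old
  bits at \<open>k\<close> on the other site. So the event does not depend on \<open>r\<close>, and
  its probability is 0 or 1.\<close>

lemma cpl_disagree:
  assumes "j < 2"
  shows "measure_pmf.prob (cpl k x y) {(x', y'). x' j \<noteq> y' j} = of_bool (j \<noteq> k \<and> x k \<noteq> y k)"
proof -
  have "(\<lambda>r. (cfg k r (x k), cfg k r (y k))) -` {(x', y'). x' j \<noteq> y' j} =
      (if j \<noteq> k \<and> x k \<noteq> y k then UNIV else {})"
    using assms by (auto simp: cfg_def)
  then show ?thesis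
    by (simp add: cpl_def)
qed

lemma influence_cpl:
  assumes "i < 2" "j < 2" "k < 2"
  shows "influence {..<2} {..<2} cpl k i j = of_bool (j \<noteq> k \<and> i = k)"
proof -
  let ?S = "agree_except {..<2} {..<2} i"
  let ?f = "\<lambda>(x, y). measure_pmf.prob (cpl k x y) {(x', y'). x' j \<noteq> y' j}"
  have f: "?f p = of_bool (j \<noteq> k \<and> fst p k \<noteq> snd p k)" for p
    by (cases p) (simp add: cpl_disagree[OF assms(2)])
  have fin: "finite ?S"
    by (rule finite_subset[of _ "configs {..<2} {..<2} \<times> configs {..<2} {..<2}"])
      (auto simp: agree_except_def finite_configs)
  \<comment> \<open>This pair differs exactly at site \<open>i\<close>, so it attains the maximum in
    every case, including those where the maximum is 0.\<close>
  have mem: "(cfg i 0 0, cfg i 1 0) \<in> ?S"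
    by (auto simp: agree_except_def cfg_in_configs) (simp add: cfg_def split: if_splits)
  have "Max (?f ` ?S) = of_bool (j \<noteq> k \<and> i = k)"
  proof (rule Max_eqI)
    show "finite (?f ` ?S)"
      using fin by simp
    show "v \<le> of_bool (j \<noteq> k \<and> i = k)" if "v \<in> ?f ` ?S" for v
    proof -
      from that obtain p where p: "p \<in> ?S" "v = ?f p"
        by blast
      have "fst p k = snd p k" if "i \<noteq> k"
        using p(1) that assms(3) by (auto simp: agree_except_def)
      then show ?thesis
        unfolding p(2) f by (auto split: if_splits)
    qed
    have "?f (cfg i 0 0, cfg i 1 0) = of_bool (j \<noteq> k \<and> i = k)"
      unfolding f using assms by (auto simp: cfg_def)
    then show "of_bool (j \<noteq> k \<and> i = k) \<in> ?f ` ?S"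
      by (metis (no_types, lifting) mem imageI)
  qed
  then show ?thesis
    by (simp add: influence_def)
qed

lemma total_influence_cpl:
  assumes "j < 2" "k < 2"
  shows "(\<Sum>i<2. influence {..<2} {..<2} cpl k i j) = of_bool (j \<noteq> k)"
proof -
  have "(\<Sum>i<2. influence {..<2} {..<2} cpl k i j) = (\<Sum>i<2. of_bool (j \<noteq> k \<and> i = k))"
    using assms by (intro sum.cong) (auto simp: influence_cpl)
  also have "\<dots> = of_bool (j \<noteq> k)"
    using assms by (auto simp: of_bool_def sum.If_cases)
  finally show ?thesis .
qed

lemma alpha_cpl: "alpha {..<2} {..<2} 2 (\<lambda>_. {..<2}) cpl = 1"
proof -
  let ?g = "\<lambda>(k, j). \<Sum>i<2. influence {..<2} {..<2} cpl k i j"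
  have "?g ` ({..<2} \<times> {..<2}) = (\<lambda>(k, j). of_bool (j \<noteq> k)) ` ({..<2::nat} \<times> {..<2::nat})"
    by (intro image_cong) (auto simp: total_influence_cpl)
  also have "\<dots> = {0, 1}"
    by (force simp: lessThan_nat_numeral lessThan_Suc)
  finally show ?thesis
    by (simp add: alpha_def)
qed

lemma alpha_W_cpl: "alpha_W {..<2} {..<2} 2 (\<lambda>_. {..<2}) cpl = 1 / 2"
proof -
  have blocks: "blocks_of 2 (\<lambda>_. {..<2}) j = {..<2}" if "j < 2" for j
    using that by (auto simp: blocks_of_def)
  let ?h = "\<lambda>j. \<Sum>k\<in>blocks_of 2 (\<lambda>_. {..<2}) j. \<Sum>i<2.
      influence {..<2} {..<2} cpl k i j / real (card (blocks_of 2 (\<lambda>_. {..<2}) j))"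
  have h: "?h j = 1 / 2" if j: "j < 2" for j
  proof -
    have "?h j = (\<Sum>k<2. of_bool (j \<noteq> k) / 2)"
      using j by (simp add: blocks flip: sum_divide_distrib) (simp add: total_influence_cpl)
    also have "\<dots> = 1 / 2"
      using j by (auto simp: numeral_2_eq_2 less_Suc_eq)
    finally show ?thesis .
  qed
  have "?h ` {..<2} = (\<lambda>_. 1 / 2) ` {..<2::nat}"
    using h by (intro image_cong) auto
  also have "\<dots> = {1 / 2}"
    by (rule image_constant[of 0]) simp
  finally show ?thesis
    by (simp add: alpha_W_def)
qed

text \<open>The final bit at site 0 is what block 1 reads at site 1, where block 0 has just written
  the old bit of site 0. The fresh bit that block 0 puts on site 0 is overwritten.\<close>

lemma scan_keeps_site_0:
  assumes "z \<in> set_pmf (scan upd [0, 1] x)"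
  shows "z 0 = x 0"
  using assms by (auto simp: upd_def cfg_def bind_return_pmf')

lemma chain_keeps_site_0:
  "z \<in> set_pmf (chain_dist (scan upd [0, 1]) t x) \<Longrightarrow> z 0 = x 0"
proof (induction t arbitrary: z)
  case 0
  then show ?case by simp
next
  case (Suc t)
  then obtain y where
    "y \<in> set_pmf (chain_dist (scan upd [0, 1]) t x)" "z \<in> set_pmf (scan upd [0, 1] y)"
    by (auto simp del: scan.simps)
  then show ?case
    using Suc.IH scan_keeps_site_0 by metis
qed

text \<open>Started with bit 0 at site 0, the chain never reaches a configuration with bit 1 there,
  although \<open>unif\<close> gives such configurations positive mass.\<close>

lemma scan_not_mixes: "\<not> mixes (configs {..<2} {..<2}) (scan upd [0, 1]) unif"
proof
  let ?S = "configs {..<2} {..<2}"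
  let ?x = "cfg 0 0 0" and ?z = "cfg 0 1 0"
  let ?d = "\<lambda>t. tv_dist ?S (chain_dist (scan upd [0, 1]) t ?x) unif"
  assume "mixes ?S (scan upd [0, 1]) unif"
  then have lim: "?d \<longlonglongrightarrow> 0"
    by (auto simp: mixes_def cfg_in_configs)
  have "?z \<in> set_pmf unif"
    by (force simp: unif_def set_bit)
  then have pos: "0 < pmf unif ?z"
    by (rule pmf_positive)
  \<comment> \<open>The unreachable point \<open>?z\<close> alone contributes its full mass under
    \<open>unif\<close> to the sum, which \<open>tv_dist\<close> halves; this bound is uniform in
    \<open>t\<close>.\<close>
  have bound: "pmf unif ?z / 2 \<le> ?d t" for t
  proof -
    have "?z \<notin> set_pmf (chain_dist (scan upd [0, 1]) t ?x)"
      using chain_keeps_site_0[of ?z t ?x] by (auto simp: cfg_def)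
    then have "pmf unif ?z = \<bar>pmf (chain_dist (scan upd [0, 1]) t ?x) ?z - pmf unif ?z\<bar>"
      by (simp add: set_pmf_iff)
    also have "\<dots> \<le> (\<Sum>z\<in>?S. \<bar>pmf (chain_dist (scan upd [0, 1]) t ?x) z - pmf unif z\<bar>)"
      by (rule member_le_sum) (auto simp: finite_configs cfg_in_configs)
    finally show ?thesis
      by (simp add: tv_dist_def)
  qed
  have "pmf unif ?z / 2 \<le> 0"
    by (rule LIMSEQ_le_const[OF lim]) (use bound in blast)
  with pos show False
    by simp
qed

theorem mainTheorem5:
  "\<exists>(V :: site set) (E :: site set set) (C :: spin set) (\<pi> :: config pmf)
     (m :: nat) (\<Theta> :: nat \<Rightarrow> site set) (P :: nat \<Rightarrow> config \<Rightarrow> config pmf)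
     (\<Psi> :: nat \<Rightarrow> config \<Rightarrow> config \<Rightarrow> (config \<times> config) pmf) (ks :: nat list).
     spin_system V E C \<pi> \<and>
     block_updates V C \<pi> m \<Theta> P \<and>
     block_couplings V C m P \<Psi> \<and>
     distinct ks \<and> set ks = {..<m} \<and>
     alpha_W V C m \<Theta> \<Psi> < 1 \<and>
     alpha V C m \<Theta> \<Psi> = 1 \<and>
     \<not> mixes (configs V C) (scan P ks) \<pi>"
proof -
  have spin: "spin_system {..<2} {{0, 1}} {..<2} unif"
    by (auto simp: spin_system_def unif_def set_bit cfg_in_configs lessThan_empty_iff)
  have updates: "block_updates {..<2} {..<2} unif 2 (\<lambda>_. {..<2}) upd"
    using upd_in_configs unif_invariant by (auto simp: block_updates_def)
  have couplings: "block_couplings {..<2} {..<2} 2 upd cpl"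
    by (simp add: block_couplings_def is_coupling_def cpl_def upd_def pmf.map_comp o_def)
  have "alpha_W {..<2} {..<2} 2 (\<lambda>_. {..<2}) cpl < 1"
    by (simp add: alpha_W_cpl)
  moreover have "distinct [0, 1::nat]" "set [0, 1] = {..<2::nat}"
    by auto
  ultimately show ?thesis
    using spin updates couplings alpha_cpl scan_not_mixes by blast
qed

end
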